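(* Let $F:(M,\phi,\xi,\eta,g)\to (N,g')$ be a bi-slant submersion from a Sasakian manifold onto a Riemannian manifold, with bi-slant angles $\theta_1,\theta_2$ and $\ker F_*=D_1\oplus D_2$. Then the distribution $D_1$ defines a totally geodesic foliation if and only if both $$-g(\mathcal{T}_U\omega\varphi V,W)=g(\mathcal{T}_U\omega V,\varphi W)+g(\mathcal{H}\nabla_U\omega V,\omega W)$$ and $$g(\mathcal{T}_U\omega V,BX)=g(\mathcal{H}\nabla_U\omega\varphi V,X)-g(\mathcal{H}\nabla_U\omega V,CX)$$ hold for all $U,V\in\Gamma(D_1)$, $W\in\Gamma(D_2)$ and $X\in\Gamma((\ker F_* )^\perp)$.
   Context: An almost contact metric manifold $(M,\phi,\xi,\eta,g)$ satisfies $\phi^2=-I+\eta\otimes\xi$, $\eta(\xi)=1$, $\eta\circ\phi=0$, $\phi\xi=0$, $g(\phi X,\phi Y)=g(X,Y)-\eta(X)\eta(Y)$. It is Sasakian (normal contact metric) with structure equations $(\nabla_X\phi)Y=g(X,Y)\xi-\eta(Y)X$ and $\nabla_X\xi=-\phi X$, where $\nabla$ is the Levi-Civita connection of $g$. A Riemannian submersion $F:(M,g)\to(N,g')$ with $\dim M>\dim N$ is a surjective map of maximal rank whose differential $F_*$ preserves lengths of horizontal vectors; $\ker F_*$ is the vertical distribution, $(\ker F_* )^\perp$ the horizontal one, with orthogonal projections $\mathcal{V}$ and $\mathcal{H}$. The O'Neill tensor $\mathcal{T}$ is $\mathcal{T}_EG=\mathcal{H}\nabla_{\mathcal{V}E}\mathcal{V}G+\mathcal{V}\nabla_{\mathcal{V}E}\mathcal{H}G$.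 Bi-slant submersion ($\xi$ horizontal): a Riemannian submersion $F$ from a Sasakian manifold with $\xi\in\Gamma((\ker F_* )^\perp)$ and an orthogonal decomposition $\ker F_*=D_1\oplus D_2$ into distributions such that for each $i=1,2$, the angle between $\phi X$ and $(D_i)_p$ equals the same constant $\theta_i$ for every $p\in M$ and every nonzero $X\in(D_i)_p$; and $\phi D_1\perp D_2$, $\phi D_2\perp D_1$. The numbers $\theta_1,\theta_2$ are the bi-slant angles. Notation: for vertical $U$, $\phi U=\varphi U+\omega U$ with $\varphi U$ vertical, $\omega U$ horizontal. For horizontal $X$, $\phi X=BX+CX$ with $BX$ vertical, $CX$ horizontal. A distribution $D$ defines a totally geodesic foliation if $\nabla_UV\in\Gamma(D)$ for all $U,V\in\Gamma(D)$. *)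

theory Defs
  imports "HOL-Analysis.Analysis"
begin

section \<open>Smooth manifolds\<close>

text \<open>
  For open \<open>S\<close> in a Euclidean space, \<open>Ck_on n S f\<close> says that all iterated directional
  derivatives of \<open>f\<close> of order at most \<open>n\<close> exist and are continuous on \<open>S\<close>.
\<close>

fun Ck_on :: "nat \<Rightarrow> 'a::real_normed_vector set \<Rightarrow> ('a \<Rightarrow> 'b::real_normed_vector) \<Rightarrow> bool" where
  "Ck_on 0 S f \<longleftrightarrow> continuous_on S f"
| "Ck_on (Suc n) S f \<longleftrightarrow>
     (\<forall>x\<in>S. f differentiable (at x)) \<and> (\<forall>v. Ck_on n S (\<lambda>x. frechet_derivative f (at x) v))"

definition smooth_on :: "'a::real_normed_vector set \<Rightarrow> ('a \<Rightarrow> 'b::real_normed_vector) \<Rightarrow> bool" where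
  "smooth_on S f \<longleftrightarrow> (\<forall>n. Ck_on n S f)"

text \<open>
  Tangent vectors will be derivations of the algebra of smooth functions. They live in the
  following real vector space of all functionals on real-valued functions.
\<close>

typedef 'm functional = "UNIV :: (('m \<Rightarrow> real) \<Rightarrow> real) set"
  morphisms app Functional ..

setup_lifting type_definition_functional

instantiation functional :: (type) real_vector
begin

lift_definition zero_functional :: "'a functional" is "\<lambda>f. 0" .
lift_definition plus_functional :: "'a functional \<Rightarrow> 'a functional \<Rightarrow> 'a functional"
  is "\<lambda>v w f. v f + w f" .
lift_definition minus_functional :: "'a functional \<Rightarrow> 'a functional \<Rightarrow> 'a functional"
  is "\<lambda>v w f. v f - w f" .
lift_definition uminus_functional :: "'a functional \<Rightarrow> 'a functional"
  is "\<lambda>v f. - v f" .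
lift_definition scaleR_functional :: "real \<Rightarrow> 'a functional \<Rightarrow> 'a functional"
  is "\<lambda>c v f. c * v f" .

instance
  by standard (transfer; simp add: fun_eq_iff algebra_simps)+

end

text \<open>
  A manifold is carried by a whole type \<open>'m\<close> and modelled on the Euclidean space \<open>'a\<close>; its
  smooth structure is given by an atlas of charts \<open>(U, c)\<close>, not required to be maximal. The
  metric is part of the record; \<open>metric M p\<close> matters only on the tangent space at \<open>p\<close>.
\<close>

type_synonym ('m, 'a) chart = "'m set \<times> ('m \<Rightarrow> 'a)"
type_synonym 'm vfield = "'m \<Rightarrow> 'm functional"
type_synonym 'm distribution = "'m \<Rightarrow> 'm functional set"
type_synonym 'm connection = "'m vfield \<Rightarrow> 'm vfield \<Rightarrow> 'm vfield"

record ('m, 'a) riem =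
  atlas :: "('m, 'a) chart set"
  metric :: "'m \<Rightarrow> 'm functional \<Rightarrow> 'm functional \<Rightarrow> real"

definition is_chart :: "('m::topological_space, 'a::euclidean_space) chart \<Rightarrow> bool" where
  "is_chart k \<longleftrightarrow> (case k of (U, c) \<Rightarrow>
     open U \<and> open (c ` U) \<and> inj_on c U \<and> continuous_on U c \<and> continuous_on (c ` U) (inv_into U c))"

definition smooth_manifold ::
  "('m::{t2_space,second_countable_topology}, 'a::euclidean_space, 'z) riem_scheme \<Rightarrow> bool" where
  "smooth_manifold M \<longleftrightarrow>
     (\<forall>k\<in>atlas M. is_chart k) \<and> (\<Union>(U, c)\<in>atlas M. U) = UNIV \<and>
     (\<forall>(U, c)\<in>atlas M. \<forall>(V, d)\<in>atlas M. smooth_on (c ` (U \<inter> V)) (d \<circ> inv_into U c))"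

definition smooth_fun_on ::
  "('m::topological_space, 'a::euclidean_space, 'z) riem_scheme \<Rightarrow> 'm set \<Rightarrow> ('m \<Rightarrow> real) \<Rightarrow> bool" where
  "smooth_fun_on M W f \<longleftrightarrow> (\<forall>(U, c)\<in>atlas M. smooth_on (c ` (U \<inter> W)) (f \<circ> inv_into U c))"

definition Cinf :: "('m::topological_space, 'a::euclidean_space, 'z) riem_scheme \<Rightarrow> ('m \<Rightarrow> real) set" where
  "Cinf M = {f. smooth_fun_on M UNIV f}"

definition smooth_map ::
  "('m::topological_space, 'a::euclidean_space, 'z) riem_scheme \<Rightarrow>
   ('n::topological_space, 'b::euclidean_space, 'y) riem_scheme \<Rightarrow> ('m \<Rightarrow> 'n) \<Rightarrow> bool" where
  "smooth_map M N F \<longleftrightarrow> continuous_on UNIV F \<and>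
     (\<forall>(U, c)\<in>atlas M. \<forall>(V, d)\<in>atlas N.
        smooth_on (c ` (U \<inter> F -` V)) (d \<circ> F \<circ> inv_into U c))"

text \<open>
  The tangent space at \<open>p\<close>: derivations at \<open>p\<close> of \<open>Cinf M\<close>, set to \<open>0\<close> on functions that are
  not smooth, so that equality of derivations is equality of functionals.
\<close>

definition tangent :: "('m::topological_space, 'a::euclidean_space, 'z) riem_scheme \<Rightarrow> 'm distribution" where
  "tangent M p = {v.
     (\<forall>f\<in>Cinf M. \<forall>h\<in>Cinf M. \<forall>a b. app v (\<lambda>x. a * f x + b * h x) = a * app v f + b * app v h) \<and>
     (\<forall>f\<in>Cinf M. \<forall>h\<in>Cinf M. app v (\<lambda>x. f x * h x) = app v f * h p + f p * app v h) \<and>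
     (\<forall>f. f \<notin> Cinf M \<longrightarrow> app v f = 0)}"

definition deriv_along :: "'m vfield \<Rightarrow> ('m \<Rightarrow> real) \<Rightarrow> 'm \<Rightarrow> real" where
  "deriv_along X f = (\<lambda>p. app (X p) f)"

definition smooth_vfield_on ::
  "('m::topological_space, 'a::euclidean_space, 'z) riem_scheme \<Rightarrow> 'm set \<Rightarrow> 'm vfield \<Rightarrow> bool" where
  "smooth_vfield_on M W X \<longleftrightarrow>
     (\<forall>p\<in>W. X p \<in> tangent M p) \<and> (\<forall>f\<in>Cinf M. smooth_fun_on M W (deriv_along X f))"

definition vfields :: "('m::topological_space, 'a::euclidean_space, 'z) riem_scheme \<Rightarrow> 'm vfield set" where
  "vfields M = {X. smooth_vfield_on M UNIV X}"

definition lie_bracket ::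
  "('m::topological_space, 'a::euclidean_space, 'z) riem_scheme \<Rightarrow> 'm vfield \<Rightarrow> 'm vfield \<Rightarrow> 'm vfield" where
  "lie_bracket M X Y = (\<lambda>p. Functional (\<lambda>f.
     if f \<in> Cinf M then app (X p) (deriv_along Y f) - app (Y p) (deriv_along X f) else 0))"

definition pushforward ::
  "('m::topological_space, 'a::euclidean_space, 'z) riem_scheme \<Rightarrow>
   ('n::topological_space, 'b::euclidean_space, 'y) riem_scheme \<Rightarrow> ('m \<Rightarrow> 'n) \<Rightarrow>
   'm functional \<Rightarrow> 'n functional" where
  "pushforward M N F v = Functional (\<lambda>h. if h \<in> Cinf N then app v (h \<circ> F) else 0)"

definition smooth_distribution ::
  "('m::topological_space, 'a::euclidean_space, 'z) riem_scheme \<Rightarrow> 'm distribution \<Rightarrow> bool" where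
  "smooth_distribution M D \<longleftrightarrow> (\<exists>k::nat. \<forall>p. \<exists>W E. open W \<and> p \<in> W \<and>
     (\<forall>i<k. smooth_vfield_on M W (E i)) \<and>
     (\<forall>q\<in>W. inj_on (\<lambda>i. E i q) {..<k} \<and> independent ((\<lambda>i. E i q) ` {..<k}) \<and>
            span ((\<lambda>i. E i q) ` {..<k}) = D q))"

definition sections ::
  "('m::topological_space, 'a::euclidean_space, 'z) riem_scheme \<Rightarrow> 'm distribution \<Rightarrow> 'm vfield set" where
  "sections M D = {X \<in> vfields M. \<forall>p. X p \<in> D p}"

section \<open>Riemannian metrics and the Levi-Civita connection\<close>

definition linear_map_on :: "'a::real_vector set \<Rightarrow> ('a \<Rightarrow> 'b::real_vector) \<Rightarrow> bool" where
  "linear_map_on S f \<longleftrightarrow>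
     (\<forall>u\<in>S. \<forall>v\<in>S. \<forall>a b. f (a *\<^sub>R u + b *\<^sub>R v) = a *\<^sub>R f u + b *\<^sub>R f v)"

definition riemannian_manifold ::
  "('m::{t2_space,second_countable_topology}, 'a::euclidean_space, 'z) riem_scheme \<Rightarrow> bool" where
  "riemannian_manifold M \<longleftrightarrow> smooth_manifold M \<and>
     (\<forall>p. \<forall>u\<in>tangent M p. linear_map_on (tangent M p) (metric M p u)) \<and>
     (\<forall>p. \<forall>u\<in>tangent M p. \<forall>v\<in>tangent M p. metric M p u v = metric M p v u) \<and>
     (\<forall>p. \<forall>u\<in>tangent M p. u \<noteq> 0 \<longrightarrow> metric M p u u > 0) \<and>
     (\<forall>W X Y. open W \<longrightarrow> smooth_vfield_on M W X \<longrightarrow> smooth_vfield_on M W Y \<longrightarrow>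
        smooth_fun_on M W (\<lambda>p. metric M p (X p) (Y p)))"

definition levi_civita ::
  "('m::{t2_space,second_countable_topology}, 'a::euclidean_space, 'z) riem_scheme \<Rightarrow>
   'm connection \<Rightarrow> bool" where
  "levi_civita M nabla \<longleftrightarrow>
     (\<forall>X\<in>vfields M. \<forall>Y\<in>vfields M. nabla X Y \<in> vfields M) \<and>
     (\<forall>X\<in>vfields M. \<forall>X'\<in>vfields M. \<forall>Y\<in>vfields M. \<forall>f\<in>Cinf M. \<forall>h\<in>Cinf M.
        nabla (\<lambda>p. f p *\<^sub>R X p + h p *\<^sub>R X' p) Y
          = (\<lambda>p. f p *\<^sub>R nabla X Y p + h p *\<^sub>R nabla X' Y p)) \<and>
     (\<forall>X\<in>vfields M. \<forall>Y\<in>vfields M. \<forall>Y'\<in>vfields M.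
        nabla X (\<lambda>p. Y p + Y' p) = (\<lambda>p. nabla X Y p + nabla X Y' p)) \<and>
     (\<forall>X\<in>vfields M. \<forall>Y\<in>vfields M. \<forall>f\<in>Cinf M.
        nabla X (\<lambda>p. f p *\<^sub>R Y p) = (\<lambda>p. deriv_along X f p *\<^sub>R Y p + f p *\<^sub>R nabla X Y p)) \<and>
     (\<forall>X\<in>vfields M. \<forall>Y\<in>vfields M. (\<lambda>p. nabla X Y p - nabla Y X p) = lie_bracket M X Y) \<and>
     (\<forall>X\<in>vfields M. \<forall>Y\<in>vfields M. \<forall>Z\<in>vfields M.
        deriv_along X (\<lambda>p. metric M p (Y p) (Z p))
          = (\<lambda>p. metric M p (nabla X Y p) (Z p) + metric M p (Y p) (nabla X Z p)))"

section \<open>Sasakian manifolds\<close>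

record ('m, 'a) acm = "('m, 'a) riem" +
  phi :: "'m \<Rightarrow> 'm functional \<Rightarrow> 'm functional"
  xi :: "'m vfield"
  eta :: "'m \<Rightarrow> 'm functional \<Rightarrow> real"

definition phi_field :: "('m, 'a, 'z) acm_scheme \<Rightarrow> 'm vfield \<Rightarrow> 'm vfield" where
  "phi_field M X = (\<lambda>p. phi M p (X p))"

definition eta_field :: "('m, 'a, 'z) acm_scheme \<Rightarrow> 'm vfield \<Rightarrow> 'm \<Rightarrow> real" where
  "eta_field M X = (\<lambda>p. eta M p (X p))"

definition almost_contact_metric ::
  "('m::{t2_space,second_countable_topology}, 'a::euclidean_space, 'z) acm_scheme \<Rightarrow> bool" where
  "almost_contact_metric M \<longleftrightarrow> riemannian_manifold M \<and>
     (\<forall>p. phi M p ` tangent M p \<subseteq> tangent M p \<and> linear_map_on (tangent M p) (phi M p)) \<and>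
     (\<forall>W X. open W \<longrightarrow> smooth_vfield_on M W X \<longrightarrow> smooth_vfield_on M W (phi_field M X)) \<and>
     xi M \<in> vfields M \<and>
     (\<forall>p. linear_map_on (tangent M p) (eta M p)) \<and>
     (\<forall>W X. open W \<longrightarrow> smooth_vfield_on M W X \<longrightarrow> smooth_fun_on M W (eta_field M X)) \<and>
     (\<forall>p. \<forall>u\<in>tangent M p. phi M p (phi M p u) = - u + eta M p u *\<^sub>R xi M p) \<and>
     (\<forall>p. eta M p (xi M p) = 1) \<and>
     (\<forall>p. \<forall>u\<in>tangent M p. eta M p (phi M p u) = 0) \<and>
     (\<forall>p. phi M p (xi M p) = 0) \<and>
     (\<forall>p. \<forall>u\<in>tangent M p. \<forall>v\<in>tangent M p.
        metric M p (phi M p u) (phi M p v) = metric M p u v - eta M p u * eta M p v)"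

text \<open>Exterior derivative of \<open>\<eta>\<close>, with the factor \<open>1/2\<close> customary in contact geometry.\<close>

definition d_eta ::
  "('m::topological_space, 'a::euclidean_space, 'z) acm_scheme \<Rightarrow> 'm vfield \<Rightarrow> 'm vfield \<Rightarrow> 'm \<Rightarrow> real" where
  "d_eta M X Y = (\<lambda>p. (deriv_along X (eta_field M Y) p - deriv_along Y (eta_field M X) p
                       - eta M p (lie_bracket M X Y p)) / 2)"

definition contact_metric ::
  "('m::{t2_space,second_countable_topology}, 'a::euclidean_space, 'z) acm_scheme \<Rightarrow> bool" where
  "contact_metric M \<longleftrightarrow> almost_contact_metric M \<and>
     (\<forall>X\<in>vfields M. \<forall>Y\<in>vfields M. d_eta M X Y = (\<lambda>p. metric M p (X p) (phi M p (Y p))))"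

definition nijenhuis ::
  "('m::topological_space, 'a::euclidean_space, 'z) acm_scheme \<Rightarrow> 'm vfield \<Rightarrow> 'm vfield \<Rightarrow> 'm vfield" where
  "nijenhuis M X Y = (\<lambda>p.
     phi M p (phi M p (lie_bracket M X Y p)) + lie_bracket M (phi_field M X) (phi_field M Y) p
     - phi M p (lie_bracket M (phi_field M X) Y p) - phi M p (lie_bracket M X (phi_field M Y) p))"

definition normal_structure ::
  "('m::topological_space, 'a::euclidean_space, 'z) acm_scheme \<Rightarrow> bool" where
  "normal_structure M \<longleftrightarrow> (\<forall>X\<in>vfields M. \<forall>Y\<in>vfields M. \<forall>p.
     nijenhuis M X Y p + (2 * d_eta M X Y p) *\<^sub>R xi M p = 0)"

text \<open>
  The two structure equations characterise normality together with \<open>d\<eta> = g(\<cdot>, \<phi> \<cdot>)\<close> among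
  almost contact metric structures; they are listed because they also fix the sign and
  normalisation conventions. \<open>nabla\<close> is meant to be the Levi-Civita connection, and
  \<open>(\<nabla>\<^sub>X \<phi>) Y = \<nabla>\<^sub>X (\<phi> Y) - \<phi> (\<nabla>\<^sub>X Y)\<close>.
\<close>

definition sasakian ::
  "('m::{t2_space,second_countable_topology}, 'a::euclidean_space, 'z) acm_scheme \<Rightarrow>
   'm connection \<Rightarrow> bool" where
  "sasakian M nabla \<longleftrightarrow> contact_metric M \<and> normal_structure M \<and>
     (\<forall>X\<in>vfields M. \<forall>Y\<in>vfields M. \<forall>p.
        nabla X (phi_field M Y) p - phi M p (nabla X Y p)
          = metric M p (X p) (Y p) *\<^sub>R xi M p - eta M p (Y p) *\<^sub>R X p) \<and>
     (\<forall>X\<in>vfields M. \<forall>p. nabla X (xi M) p = - phi M p (X p))"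

section \<open>Riemannian and bi-slant submersions\<close>

definition vertical ::
  "('m::topological_space, 'a::euclidean_space, 'z) riem_scheme \<Rightarrow>
   ('n::topological_space, 'b::euclidean_space, 'y) riem_scheme \<Rightarrow> ('m \<Rightarrow> 'n) \<Rightarrow> 'm distribution" where
  "vertical M N F p = {v \<in> tangent M p. pushforward M N F v = 0}"

definition horizontal ::
  "('m::topological_space, 'a::euclidean_space, 'z) riem_scheme \<Rightarrow>
   ('n::topological_space, 'b::euclidean_space, 'y) riem_scheme \<Rightarrow> ('m \<Rightarrow> 'n) \<Rightarrow> 'm distribution" where
  "horizontal M N F p = {v \<in> tangent M p. \<forall>w\<in>vertical M N F p. metric M p v w = 0}"

definition vlength ::
  "('m, 'a, 'z) riem_scheme \<Rightarrow> 'm \<Rightarrow> 'm functional \<Rightarrow> real" where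
  "vlength M p v = sqrt (metric M p v v)"

definition riemannian_submersion ::
  "('m::{t2_space,second_countable_topology}, 'a::euclidean_space, 'z) riem_scheme \<Rightarrow>
   ('n::{t2_space,second_countable_topology}, 'b::euclidean_space, 'y) riem_scheme \<Rightarrow>
   ('m \<Rightarrow> 'n) \<Rightarrow> bool" where
  "riemannian_submersion M N F \<longleftrightarrow>
     riemannian_manifold M \<and> riemannian_manifold N \<and> DIM('a) > DIM('b) \<and>
     smooth_map M N F \<and> surj F \<and>
     (\<forall>p. pushforward M N F ` tangent M p = tangent N (F p)) \<and>
     (\<forall>p. \<forall>v\<in>horizontal M N F p. vlength N (F p) (pushforward M N F v) = vlength M p v)"

definition orth_proj ::
  "('m, 'a, 'z) riem_scheme \<Rightarrow> 'm \<Rightarrow> 'm functional set \<Rightarrow> 'm functional \<Rightarrow> 'm functional" where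
  "orth_proj M p S v = (THE w. w \<in> S \<and> (\<forall>s\<in>S. metric M p (v - w) s = 0))"

definition ver ::
  "('m::topological_space, 'a::euclidean_space, 'z) riem_scheme \<Rightarrow>
   ('n::topological_space, 'b::euclidean_space, 'y) riem_scheme \<Rightarrow> ('m \<Rightarrow> 'n) \<Rightarrow>
   'm vfield \<Rightarrow> 'm vfield" where
  "ver M N F X = (\<lambda>p. orth_proj M p (vertical M N F p) (X p))"

definition hor ::
  "('m::topological_space, 'a::euclidean_space, 'z) riem_scheme \<Rightarrow>
   ('n::topological_space, 'b::euclidean_space, 'y) riem_scheme \<Rightarrow> ('m \<Rightarrow> 'n) \<Rightarrow>
   'm vfield \<Rightarrow> 'm vfield" where
  "hor M N F X = (\<lambda>p. orth_proj M p (horizontal M N F p) (X p))"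

definition oneill_T ::
  "('m::topological_space, 'a::euclidean_space, 'z) riem_scheme \<Rightarrow>
   ('n::topological_space, 'b::euclidean_space, 'y) riem_scheme \<Rightarrow> ('m \<Rightarrow> 'n) \<Rightarrow>
   'm connection \<Rightarrow> 'm vfield \<Rightarrow> 'm vfield \<Rightarrow> 'm vfield" where
  "oneill_T M N F nabla E G = (\<lambda>p.
     hor M N F (nabla (ver M N F E) (ver M N F G)) p
     + ver M N F (nabla (ver M N F E) (hor M N F G)) p)"

text \<open>
  The angle, in \<open>[0, \<pi>/2]\<close>, between a nonzero vector and a subspace, i.e. between the vector and
  its orthogonal projection; it is \<open>\<pi>/2\<close> when the projection vanishes.
\<close>

definition angle_subspace ::
  "('m, 'a, 'z) riem_scheme \<Rightarrow> 'm \<Rightarrow> 'm functional \<Rightarrow> 'm functional set \<Rightarrow> real" where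
  "angle_subspace M p v S = arccos (vlength M p (orth_proj M p S v) / vlength M p v)"

definition slant_distribution ::
  "('m, 'a, 'z) acm_scheme \<Rightarrow> 'm distribution \<Rightarrow> real \<Rightarrow> bool" where
  "slant_distribution M D \<theta> \<longleftrightarrow>
     (\<forall>p. \<forall>v\<in>D p. v \<noteq> 0 \<longrightarrow> angle_subspace M p (phi M p v) (D p) = \<theta>)"

definition bi_slant_submersion ::
  "('m::{t2_space,second_countable_topology}, 'a::euclidean_space, 'z) acm_scheme \<Rightarrow>
   ('n::{t2_space,second_countable_topology}, 'b::euclidean_space, 'y) riem_scheme \<Rightarrow>
   ('m \<Rightarrow> 'n) \<Rightarrow> 'm distribution \<Rightarrow> 'm distribution \<Rightarrow> real \<Rightarrow> real \<Rightarrow> bool" where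
  "bi_slant_submersion M N F D1 D2 \<theta>1 \<theta>2 \<longleftrightarrow>
     riemannian_submersion M N F \<and>
     xi M \<in> sections M (horizontal M N F) \<and>
     smooth_distribution M D1 \<and> smooth_distribution M D2 \<and>
     (\<forall>p. vertical M N F p = {u + v |u v. u \<in> D1 p \<and> v \<in> D2 p}) \<and>
     (\<forall>p. \<forall>u\<in>D1 p. \<forall>v\<in>D2 p. metric M p u v = 0) \<and>
     slant_distribution M D1 \<theta>1 \<and> slant_distribution M D2 \<theta>2 \<and>
     (\<forall>p. \<forall>u\<in>D1 p. \<forall>v\<in>D2 p. metric M p (phi M p u) v = 0 \<and> metric M p (phi M p v) u = 0)"

text \<open>
  The parts of \<open>\<phi>\<close>: \<open>\<phi> U = varphi U + omega U\<close> for vertical \<open>U\<close> and \<open>\<phi> X = B_part X + C_part X\<close> for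
  horizontal \<open>X\<close>.
\<close>

definition varphi ::
  "('m::topological_space, 'a::euclidean_space, 'z) acm_scheme \<Rightarrow>
   ('n::topological_space, 'b::euclidean_space, 'y) riem_scheme \<Rightarrow> ('m \<Rightarrow> 'n) \<Rightarrow>
   'm vfield \<Rightarrow> 'm vfield" where
  "varphi M N F U = ver M N F (phi_field M U)"

definition omega ::
  "('m::topological_space, 'a::euclidean_space, 'z) acm_scheme \<Rightarrow>
   ('n::topological_space, 'b::euclidean_space, 'y) riem_scheme \<Rightarrow> ('m \<Rightarrow> 'n) \<Rightarrow>
   'm vfield \<Rightarrow> 'm vfield" where
  "omega M N F U = hor M N F (phi_field M U)"

definition B_part ::
  "('m::topological_space, 'a::euclidean_space, 'z) acm_scheme \<Rightarrow>
   ('n::topological_space, 'b::euclidean_space, 'y) riem_scheme \<Rightarrow> ('m \<Rightarrow> 'n) \<Rightarrow>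
   'm vfield \<Rightarrow> 'm vfield" where
  "B_part M N F X = ver M N F (phi_field M X)"

definition C_part ::
  "('m::topological_space, 'a::euclidean_space, 'z) acm_scheme \<Rightarrow>
   ('n::topological_space, 'b::euclidean_space, 'y) riem_scheme \<Rightarrow> ('m \<Rightarrow> 'n) \<Rightarrow>
   'm vfield \<Rightarrow> 'm vfield" where
  "C_part M N F X = hor M N F (phi_field M X)"

definition totally_geodesic_foliation ::
  "('m::topological_space, 'a::euclidean_space, 'z) riem_scheme \<Rightarrow>
   'm connection \<Rightarrow> 'm distribution \<Rightarrow> bool" where
  "totally_geodesic_foliation M nabla D \<longleftrightarrow>
     (\<forall>U\<in>sections M D. \<forall>V\<in>sections M D. nabla U V \<in> sections M D)"

end

theory Submission
  imports Defs
begin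

text \<open>
  Since \<open>\<xi>\<close> is horizontal, \<open>\<eta>\<close> vanishes on vertical fields, and these are closed under the Lie
  bracket, so \<open>g(U, \<phi> V) = d\<eta>(U, V) = 0\<close> for all vertical \<open>U, V\<close>. Thus \<open>\<phi>\<close> maps vertical to
  horizontal fields: \<open>\<varphi> V = 0\<close> and \<open>\<omega> V = \<phi> V\<close>. As \<open>\<eta>(\<nabla>\<^sub>U V) = g(V, \<phi> U) = 0\<close>, the formula for
  \<open>\<nabla>\<phi>\<close> gives \<open>g(\<nabla>\<^sub>U \<phi> V, \<phi> Y) = g(\<nabla>\<^sub>U V, Y)\<close> for every \<open>Y\<close>. The two conditions therefore say that
  \<open>\<nabla>\<^sub>U V\<close> is orthogonal to all sections of \<open>D\<^sub>2\<close> and to all horizontal fields. Testing against the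
  \<open>D\<^sub>2\<close>-component and the horizontal component of \<open>\<nabla>\<^sub>U V\<close>, which are smooth by Gram--Schmidt in local
  frames, this means \<open>\<nabla>\<^sub>U V \<in> \<Gamma>(D\<^sub>1)\<close>.
\<close>

section \<open>Smooth functions and vector fields\<close>

text \<open>At a point of an open set, \<open>has_derivative\<close> depends only on the values on
  that set, and both \<open>differentiable\<close> and the choice made in
  \<open>frechet_derivative\<close> refer to that predicate alone.\<close>

lemma frechet_derivative_cong_open:
  fixes f g :: "'a::real_normed_vector \<Rightarrow> 'b::real_normed_vector"
  assumes "open S" "x \<in> S" "\<And>y. y \<in> S \<Longrightarrow> f y = g y"
  shows "f differentiable (at x) \<longleftrightarrow> g differentiable (at x)"
    and "frechet_derivative f (at x) = frechet_derivative g (at x)"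
proof -
  have "(f has_derivative d) (at x) \<longleftrightarrow> (g has_derivative d) (at x)" for d
    using assms has_derivative_transform_within_open[of f d x UNIV S g]
      has_derivative_transform_within_open[of g d x UNIV S f] by auto
  then show "f differentiable (at x) \<longleftrightarrow> g differentiable (at x)"
    and "frechet_derivative f (at x) = frechet_derivative g (at x)"
    unfolding differentiable_def frechet_derivative_def by auto
qed

lemma Ck_on_cong:
  assumes "open S" "\<And>x. x \<in> S \<Longrightarrow> f x = g x"
  shows "Ck_on n S f \<longleftrightarrow> Ck_on n S g"
  using assms(2)
proof (induction n arbitrary: f g)
  case 0
  then show ?case by (auto cong: continuous_on_cong)
next
  case (Suc n)
  note c = frechet_derivative_cong_open[OF assms(1) _ Suc.prems]
  have "Ck_on n S (\<lambda>x. frechet_derivative f (at x) v)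
      \<longleftrightarrow> Ck_on n S (\<lambda>x. frechet_derivative g (at x) v)" for v
    by (rule Suc.IH) (simp add: c(2))
  then show ?case using c(1) by auto
qed

lemma Ck_on_Suc_D: "Ck_on (Suc n) S f \<Longrightarrow> Ck_on n S f"
proof (induction n arbitrary: f)
  case 0
  then show ?case
    by (simp add: continuous_at_imp_continuous_on differentiable_imp_continuous_within)
next
  case (Suc n)
  show ?case
    using Suc.prems Suc.IH by (metis Ck_on.simps(2))
qed

text \<open>Uniqueness of the Frechet derivative lets an explicit formula \<open>d\<close> replace
  the chosen one, so the calculus rules below only have to name their derivative.\<close>

lemma Ck_on_SucI:
  assumes "open S" "\<And>x. x \<in> S \<Longrightarrow> (f has_derivative d x) (at x)"
    and "\<And>v. Ck_on n S (\<lambda>x. d x v)"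
  shows "Ck_on (Suc n) S f"
proof -
  have "Ck_on n S (\<lambda>x. frechet_derivative f (at x) v)" for v
    using Ck_on_cong[OF assms(1), of "\<lambda>x. frechet_derivative f (at x) v" "\<lambda>x. d x v"]
      assms(2,3) frechet_derivative_at by metis
  then show ?thesis
    using assms(2) by (auto simp: differentiable_def)
qed

lemma Ck_on_SucD:
  assumes "Ck_on (Suc n) S f"
  shows "x \<in> S \<Longrightarrow> (f has_derivative frechet_derivative f (at x)) (at x)"
    and "Ck_on n S (\<lambda>x. frechet_derivative f (at x) v)"
  using assms frechet_derivative_works by auto

lemma Ck_on_const: "open S \<Longrightarrow> Ck_on n S (\<lambda>x. c)"
proof (induction n arbitrary: c)
  case (Suc n)
  show ?case
    by (rule Ck_on_SucI[where d = "\<lambda>x v. 0"]) (use Suc in auto)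
qed simp

lemma Ck_on_add:
  assumes "open S" "Ck_on n S f" "Ck_on n S g"
  shows "Ck_on n S (\<lambda>x. f x + g x)"
  using assms(2,3)
proof (induction n arbitrary: f g)
  case 0
  then show ?case by (auto intro: continuous_intros)
next
  case (Suc n)
  show ?case
  proof (rule Ck_on_SucI[OF assms(1)])
    show "((\<lambda>x. f x + g x) has_derivative
      (\<lambda>v. frechet_derivative f (at x) v + frechet_derivative g (at x) v)) (at x)"
      if "x \<in> S" for x
      using Ck_on_SucD(1)[OF Suc.prems(1) that] Ck_on_SucD(1)[OF Suc.prems(2) that]
      by (rule has_derivative_add)
  qed (intro Suc.IH Ck_on_SucD(2)[OF Suc.prems(1)] Ck_on_SucD(2)[OF Suc.prems(2)])
qed

text \<open>The product rule leaves one factor undifferentiated in each term;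
  \<open>Ck_on_Suc_D\<close> brings that factor down to order \<open>n\<close>, where the induction
  hypothesis applies.\<close>

lemma Ck_on_mult:
  fixes f g :: "'a::real_normed_vector \<Rightarrow> real"
  assumes "open S" "Ck_on n S f" "Ck_on n S g"
  shows "Ck_on n S (\<lambda>x. f x * g x)"
  using assms(2,3)
proof (induction n arbitrary: f g)
  case 0
  then show ?case by (auto intro: continuous_intros)
next
  case (Suc n)
  show ?case
  proof (rule Ck_on_SucI[OF assms(1)])
    show "((\<lambda>x. f x * g x) has_derivative
      (\<lambda>v. f x * frechet_derivative g (at x) v + frechet_derivative f (at x) v * g x)) (at x)"
      if "x \<in> S" for x
      using Ck_on_SucD(1)[OF Suc.prems(1) that] Ck_on_SucD(1)[OF Suc.prems(2) that]
      by (rule has_derivative_mult)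
  qed (intro Ck_on_add assms(1) Suc.IH Ck_on_SucD(2)[OF Suc.prems(1)]
      Ck_on_SucD(2)[OF Suc.prems(2)] Ck_on_Suc_D[OF Suc.prems(1)] Ck_on_Suc_D[OF Suc.prems(2)])
qed

text \<open>As (1/f)' = -f'/f^2, order \<open>n\<close> of the reciprocal yields the next order. The
  derivative is written as a product with the constant -1, so that the rules for products and
  constants suffice.\<close>

lemma Ck_on_inverse:
  fixes f :: "'a::real_normed_vector \<Rightarrow> real"
  assumes "open S" "Ck_on n S f" "\<And>x. x \<in> S \<Longrightarrow> f x \<noteq> 0"
  shows "Ck_on n S (\<lambda>x. inverse (f x))"
  using assms(2)
proof (induction n)
  case 0
  then show ?case using assms(3) by (auto intro: continuous_intros)
next
  case (Suc n)
  have i: "Ck_on n S (\<lambda>x. inverse (f x))"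
    using Suc Ck_on_Suc_D by blast
  show ?case
  proof (rule Ck_on_SucI[OF assms(1)])
    show "((\<lambda>x. inverse (f x)) has_derivative
      (\<lambda>v. (-1) * (inverse (f x) * frechet_derivative f (at x) v * inverse (f x)))) (at x)"
      if "x \<in> S" for x
      using Deriv.has_derivative_inverse[OF assms(3)[OF that] Ck_on_SucD(1)[OF Suc.prems that]]
      by simp
  qed (intro Ck_on_mult Ck_on_const assms(1) i Ck_on_SucD(2)[OF Suc.prems(1)])
qed

text \<open>Continuity and differentiability are local on open sets; this is the basis for gluing
  smooth local pieces.\<close>

lemma Ck_on_Union:
  assumes "\<And>T. T \<in> \<T> \<Longrightarrow> open T" "\<And>T. T \<in> \<T> \<Longrightarrow> Ck_on n T f"
  shows "Ck_on n (\<Union>\<T>) f"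
  using assms(2)
proof (induction n arbitrary: f)
  case 0
  then show ?case using continuous_on_open_Union[of \<T> f] assms(1) by auto
qed auto

lemma Ck_on_subset: "Ck_on n S f \<Longrightarrow> T \<subseteq> S \<Longrightarrow> Ck_on n T f"
proof (induction n arbitrary: f)
  case 0
  then show ?case using continuous_on_subset by auto
qed auto

section \<open>Smooth functions in charts\<close>

lemma open_chart_image:
  assumes "smooth_manifold M" "(U, c) \<in> atlas M" "open W"
  shows "open (c ` (U \<inter> W))"
proof -
  have ch: "open (c ` U)" "inj_on c U" "continuous_on (c ` U) (inv_into U c)"
    using assms unfolding smooth_manifold_def is_chart_def by auto
  \<comment> \<open>The set is a preimage of \<open>W\<close> under the inverse chart, which is
    continuous on the open image of the chart.\<close>
  have "c ` (U \<inter> W) = c ` U \<inter> inv_into U c -` W"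
    using ch(2) by (auto simp: inv_into_f_f)
  then show ?thesis
    using continuous_open_preimage[OF ch(3,1) assms(3)] by simp
qed

lemma smooth_fun_onI:
  assumes "\<And>U c n. (U, c) \<in> atlas M \<Longrightarrow> Ck_on n (c ` (U \<inter> W)) (\<lambda>x. f (inv_into U c x))"
  shows "smooth_fun_on M W f"
  using assms unfolding smooth_fun_on_def smooth_on_def comp_def by auto

lemma smooth_fun_onD:
  "smooth_fun_on M W f \<Longrightarrow> (U, c) \<in> atlas M \<Longrightarrow> Ck_on n (c ` (U \<inter> W)) (\<lambda>x. f (inv_into U c x))"
  unfolding smooth_fun_on_def smooth_on_def comp_def by auto

lemma smooth_fun_on_const:
  assumes "smooth_manifold M" "open W"
  shows "smooth_fun_on M W (\<lambda>x. c)"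
  by (intro smooth_fun_onI Ck_on_const open_chart_image[OF assms(1) _ assms(2)])

lemma smooth_fun_on_add:
  assumes "smooth_manifold M" "open W" "smooth_fun_on M W f" "smooth_fun_on M W h"
  shows "smooth_fun_on M W (\<lambda>x. f x + h x)"
  by (intro smooth_fun_onI Ck_on_add open_chart_image[OF assms(1) _ assms(2)]
      smooth_fun_onD[OF assms(3)] smooth_fun_onD[OF assms(4)])

lemma smooth_fun_on_mult:
  assumes "smooth_manifold M" "open W" "smooth_fun_on M W f" "smooth_fun_on M W h"
  shows "smooth_fun_on M W (\<lambda>x. f x * h x)"
  by (intro smooth_fun_onI Ck_on_mult open_chart_image[OF assms(1) _ assms(2)]
      smooth_fun_onD[OF assms(3)] smooth_fun_onD[OF assms(4)])

lemma smooth_fun_on_inverse: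
  assumes "smooth_manifold M" "open W" "smooth_fun_on M W f" "\<And>x. x \<in> W \<Longrightarrow> f x \<noteq> 0"
  shows "smooth_fun_on M W (\<lambda>x. inverse (f x))"
proof (rule smooth_fun_onI)
  fix U c n assume k: "(U, c) \<in> atlas M"
  then have "inj_on c U"
    using assms(1) unfolding smooth_manifold_def is_chart_def by auto
  then show "Ck_on n (c ` (U \<inter> W)) (\<lambda>x. inverse (f (inv_into U c x)))"
    by (intro Ck_on_inverse open_chart_image[OF assms(1) k assms(2)] smooth_fun_onD[OF assms(3) k])
      (auto simp: inv_into_f_f assms(4))
qed

lemma smooth_fun_on_subset: "smooth_fun_on M W f \<Longrightarrow> W' \<subseteq> W \<Longrightarrow> smooth_fun_on M W' f"
  by (rule smooth_fun_onI, rule Ck_on_subset[OF smooth_fun_onD]) auto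

text \<open>In a chart, the images of the neighbourhoods in \<open>loc\<close> form an open cover of
  the chart image, and on each of them \<open>f\<close> has the expression of a smooth
  function.\<close>

lemma smooth_fun_on_local:
  assumes "smooth_manifold M"
    and loc: "\<And>p. \<exists>W h. open W \<and> p \<in> W \<and> smooth_fun_on M W h \<and> (\<forall>q\<in>W. f q = h q)"
  shows "smooth_fun_on M UNIV f"
proof (rule smooth_fun_onI)
  fix U c n assume k: "(U, c) \<in> atlas M"
  then have inj: "inj_on c U"
    using assms(1) unfolding smooth_manifold_def is_chart_def by auto
  define \<W> where "\<W> = {W. open W \<and> (\<exists>h. smooth_fun_on M W h \<and> (\<forall>q\<in>W. f q = h q))}"
  define \<T> where "\<T> = (\<lambda>W. c ` (U \<inter> W)) ` \<W>"
  have "Ck_on n (\<Union>\<T>) (\<lambda>x. f (inv_into U c x))"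
  proof (rule Ck_on_Union)
    fix T assume "T \<in> \<T>"
    then obtain W h where T: "T = c ` (U \<inter> W)" "open W" "smooth_fun_on M W h" "\<forall>q\<in>W. f q = h q"
      unfolding \<T>_def \<W>_def by auto
    show o: "open T" using open_chart_image[OF assms(1) k] T by simp
    have "f (inv_into U c x) = h (inv_into U c x)" if "x \<in> T" for x
      using that T(1,4) inj by (auto simp: inv_into_f_f)
    then show "Ck_on n T (\<lambda>x. f (inv_into U c x))"
      using Ck_on_cong[OF o, of "\<lambda>x. f (inv_into U c x)" "\<lambda>x. h (inv_into U c x)" n]
        smooth_fun_onD[OF T(3) k, of n] T(1) by simp
  qed
  moreover have "\<exists>W\<in>\<W>. p \<in> W" for p
    using loc[of p] unfolding \<W>_def by auto
  then have "\<Union>\<T> = c ` (U \<inter> UNIV)"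
    unfolding \<T>_def by auto
  ultimately show "Ck_on n (c ` (U \<inter> UNIV)) (\<lambda>x. f (inv_into U c x))"
    by simp
qed

section \<open>Tangent vectors and smooth vector fields\<close>

lemmas app_simps = zero_functional.rep_eq plus_functional.rep_eq minus_functional.rep_eq
  uminus_functional.rep_eq scaleR_functional.rep_eq

lemma tangent_subspace: "subspace (tangent M p)"
  unfolding subspace_def tangent_def by (auto simp: app_simps algebra_simps)

lemma app_tangent_zero:
  assumes "smooth_manifold M" "v \<in> tangent M p"
  shows "app v (\<lambda>x. 0) = 0"
proof -
  \<comment> \<open>Linearity in \<open>tangent\<close> is stated on \<open>Cinf M\<close>, so the
    zero function is first shown to be smooth; both coefficients are then taken to be 0.\<close>
  have z: "(\<lambda>x. 0) \<in> Cinf M"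
    using smooth_fun_on_const[OF assms(1)] by (simp add: Cinf_def)
  have "\<forall>f\<in>Cinf M. \<forall>h\<in>Cinf M. \<forall>a b.
      app v (\<lambda>x. a * f x + b * h x) = a * app v f + b * app v h"
    using assms(2) by (simp add: tangent_def)
  from bspec[OF bspec[OF this z] z, rule_format, of 0 0] show ?thesis by simp
qed

text \<open>Deriving a function along a combination gives the same combination of the derived
  functions. Two function coefficients cover sums, differences and the Gram-Schmidt correction at
  once.\<close>

lemma smooth_vfield_on_lincomb:
  assumes "smooth_manifold M" "open W" "smooth_vfield_on M W X" "smooth_vfield_on M W Y"
    "smooth_fun_on M W f" "smooth_fun_on M W h"
  shows "smooth_vfield_on M W (\<lambda>p. f p *\<^sub>R X p + h p *\<^sub>R Y p)"
proof -
  have "f p *\<^sub>R X p + h p *\<^sub>R Y p \<in> tangent M p" if "p \<in> W" for p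
    using that assms(3,4) tangent_subspace[of M p] unfolding smooth_vfield_on_def
    by (simp add: subspace_add subspace_scale)
  moreover have "smooth_fun_on M W (deriv_along (\<lambda>p. f p *\<^sub>R X p + h p *\<^sub>R Y p) u)"
    if "u \<in> Cinf M" for u
  proof -
    have "deriv_along (\<lambda>p. f p *\<^sub>R X p + h p *\<^sub>R Y p) u
        = (\<lambda>p. f p * deriv_along X u p + h p * deriv_along Y u p)"
      by (auto simp: deriv_along_def app_simps)
    then show ?thesis
      using that assms(3,4) unfolding smooth_vfield_on_def
      by (auto intro!: smooth_fun_on_add smooth_fun_on_mult assms)
  qed
  ultimately show ?thesis by (auto simp: smooth_vfield_on_def)
qed

lemma smooth_vfield_on_zero:
  "smooth_manifold M \<Longrightarrow> open W \<Longrightarrow> smooth_vfield_on M W (\<lambda>p. 0)"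
  unfolding smooth_vfield_on_def
  by (auto simp: subspace_0[OF tangent_subspace] deriv_along_def app_simps smooth_fun_on_const)

lemma smooth_vfield_on_add:
  assumes "smooth_manifold M" "open W" "smooth_vfield_on M W X" "smooth_vfield_on M W Y"
  shows "smooth_vfield_on M W (\<lambda>p. X p + Y p)"
  using smooth_vfield_on_lincomb[OF assms smooth_fun_on_const[OF assms(1,2), of 1]
      smooth_fun_on_const[OF assms(1,2), of 1]] by simp

lemma smooth_vfield_on_diff:
  assumes "smooth_manifold M" "open W" "smooth_vfield_on M W X" "smooth_vfield_on M W Y"
  shows "smooth_vfield_on M W (\<lambda>p. X p - Y p)"
  using smooth_vfield_on_lincomb[OF assms smooth_fun_on_const[OF assms(1,2), of 1]
      smooth_fun_on_const[OF assms(1,2), of "- 1"]] by simp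

lemma smooth_vfield_on_subset:
  "smooth_vfield_on M W X \<Longrightarrow> W' \<subseteq> W \<Longrightarrow> smooth_vfield_on M W' X"
  unfolding smooth_vfield_on_def using smooth_fun_on_subset by blast

lemma smooth_vfield_on_local:
  assumes "smooth_manifold M"
    and loc: "\<And>p. \<exists>W Y. open W \<and> p \<in> W \<and> smooth_vfield_on M W Y \<and> (\<forall>q\<in>W. X q = Y q)"
  shows "smooth_vfield_on M UNIV X"
  unfolding smooth_vfield_on_def
proof (intro conjI ballI)
  fix p show "X p \<in> tangent M p"
    using loc[of p] unfolding smooth_vfield_on_def by auto
next
  fix f assume f: "f \<in> Cinf M"
  show "smooth_fun_on M UNIV (deriv_along X f)"
  proof (rule smooth_fun_on_local[OF assms(1)])
    fix p
    obtain W Y where "open W" "p \<in> W" "smooth_vfield_on M W Y" "\<forall>q\<in>W. X q = Y q"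
      using loc by blast
    then show "\<exists>W h. open W \<and> p \<in> W \<and> smooth_fun_on M W h \<and> (\<forall>q\<in>W. deriv_along X f q = h q)"
      using f by (intro exI[of _ W] exI[of _ "deriv_along Y f"])
        (auto simp: smooth_vfield_on_def deriv_along_def)
  qed
qed

section \<open>Smoothness of orthogonal projections\<close>

locale riemannian =
  fixes M :: "('m::{t2_space,second_countable_topology}, 'a::euclidean_space, 'z) riem_scheme"
  assumes riem: "riemannian_manifold M"
begin

lemma smooth_manifold: "smooth_manifold M"
  using riem by (simp add: riemannian_manifold_def)

lemma metric_commute:
  assumes "u \<in> tangent M p" "v \<in> tangent M p"
  shows "metric M p u v = metric M p v u"
proof -
  have "\<forall>p. \<forall>u\<in>tangent M p. \<forall>v\<in>tangent M p. metric M p u v = metric M p v u"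
    using riem unfolding riemannian_manifold_def by (elim conjE)
  then show ?thesis using assms by blast
qed

lemma metric_lincomb_right:
  assumes "u \<in> tangent M p" "v \<in> tangent M p" "w \<in> tangent M p"
  shows "metric M p u (a *\<^sub>R v + b *\<^sub>R w) = a * metric M p u v + b * metric M p u w"
proof -
  have "\<forall>p. \<forall>u\<in>tangent M p. linear_map_on (tangent M p) (metric M p u)"
    using riem unfolding riemannian_manifold_def by (elim conjE)
  then show ?thesis
    using assms unfolding linear_map_on_def by simp
qed

lemma metric_add_right:
  "u \<in> tangent M p \<Longrightarrow> v \<in> tangent M p \<Longrightarrow> w \<in> tangent M p \<Longrightarrow>
    metric M p u (v + w) = metric M p u v + metric M p u w"
  using metric_lincomb_right[of u p v w 1 1] by simp

lemma metric_diff_right: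
  "u \<in> tangent M p \<Longrightarrow> v \<in> tangent M p \<Longrightarrow> w \<in> tangent M p \<Longrightarrow>
    metric M p u (v - w) = metric M p u v - metric M p u w"
  using metric_lincomb_right[of u p v w 1 "-1"] by simp

lemma metric_scale_right:
  "u \<in> tangent M p \<Longrightarrow> v \<in> tangent M p \<Longrightarrow> metric M p u (a *\<^sub>R v) = a * metric M p u v"
  using metric_lincomb_right[of u p v v a 0] by simp

lemma metric_zero_right: "u \<in> tangent M p \<Longrightarrow> metric M p u 0 = 0"
  using metric_scale_right[of u p u 0] by simp

lemma metric_add_left:
  "u \<in> tangent M p \<Longrightarrow> v \<in> tangent M p \<Longrightarrow> w \<in> tangent M p \<Longrightarrow>
    metric M p (u + v) w = metric M p u w + metric M p v w"
  by (simp add: metric_commute[of _ p w] metric_add_right subspace_add[OF tangent_subspace])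

lemma metric_diff_left:
  "u \<in> tangent M p \<Longrightarrow> v \<in> tangent M p \<Longrightarrow> w \<in> tangent M p \<Longrightarrow>
    metric M p (u - v) w = metric M p u w - metric M p v w"
  by (simp add: metric_commute[of _ p w] metric_diff_right subspace_diff[OF tangent_subspace])

lemma metric_scale_left:
  "u \<in> tangent M p \<Longrightarrow> v \<in> tangent M p \<Longrightarrow> metric M p (a *\<^sub>R u) v = a * metric M p u v"
  by (simp add: metric_commute[of _ p v] metric_scale_right subspace_scale[OF tangent_subspace])

lemma metric_zero_left: "v \<in> tangent M p \<Longrightarrow> metric M p 0 v = 0"
  using metric_scale_left[of v p v 0] by simp

lemma metric_self_eq_0:
  assumes "u \<in> tangent M p" "metric M p u u = 0"
  shows "u = 0"
proof -
  have "\<forall>p. \<forall>u\<in>tangent M p. u \<noteq> 0 \<longrightarrow> metric M p u u > 0"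
    using riem unfolding riemannian_manifold_def by (elim conjE)
  then show ?thesis using assms by force
qed

lemmas metric_simps = metric_add_left metric_add_right metric_diff_left metric_diff_right
  metric_scale_left metric_scale_right metric_zero_left metric_zero_right

lemmas tangent_closed = subspace_0[OF tangent_subspace] subspace_add[OF tangent_subspace]
  subspace_diff[OF tangent_subspace]
  subspace_scale[OF tangent_subspace]

lemma smooth_metric:
  assumes "open W" "smooth_vfield_on M W X" "smooth_vfield_on M W Y"
  shows "smooth_fun_on M W (\<lambda>p. metric M p (X p) (Y p))"
proof -
  have "\<forall>W X Y. open W \<longrightarrow> smooth_vfield_on M W X \<longrightarrow> smooth_vfield_on M W Y \<longrightarrow>
      smooth_fun_on M W (\<lambda>p. metric M p (X p) (Y p))"
    using riem unfolding riemannian_manifold_def by (elim conjE)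
  then show ?thesis using assms by simp
qed

text \<open>Gram--Schmidt: \<open>e\<close> is the part of \<open>E k\<close> orthogonal to the earlier frame vectors.\<close>

lemma frame_projection:
  fixes E :: "nat \<Rightarrow> 'm vfield"
  assumes W: "open W"
    and "\<And>i. i < k \<Longrightarrow> smooth_vfield_on M W (E i)"
    and "\<And>q. q \<in> W \<Longrightarrow> inj_on (\<lambda>i. E i q) {..<k} \<and> independent ((\<lambda>i. E i q) ` {..<k})"
    and "smooth_vfield_on M W X"
  shows "\<exists>Y. smooth_vfield_on M W Y \<and> (\<forall>q\<in>W. Y q \<in> span ((\<lambda>i. E i q) ` {..<k}) \<and>
      (\<forall>s\<in>span ((\<lambda>i. E i q) ` {..<k}). metric M q (X q - Y q) s = 0))"
  using assms(2-4)
proof (induction k arbitrary: X)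
  case 0
  have "metric M q (X q - 0) 0 = 0" if "q \<in> W" for q
    using 0(3) that by (auto simp: smooth_vfield_on_def intro!: metric_zero_right)
  then show ?case
    using smooth_vfield_on_zero[OF smooth_manifold W] by (intro exI[of _ "\<lambda>p. 0"]) auto
next
  case (Suc k)
  let ?S = "\<lambda>q. span ((\<lambda>i. E i q) ` {..<k})"
  have frame: "inj_on (\<lambda>i. E i q) {..<k} \<and> independent ((\<lambda>i. E i q) ` {..<k})"
      and notin: "E k q \<notin> ?S q" if "q \<in> W" for q
  proof -
    \<comment> \<open>Injectivity separates \<open>E k q\<close> from the earlier vectors; only then
      does independence of the enlarged set place it outside their span.\<close>
    have "inj_on (\<lambda>i. E i q) (insert k {..<k})" "independent (insert (E k q) ((\<lambda>i. E i q) ` {..<k}))"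
      using Suc.prems(2)[OF that] by (simp_all add: lessThan_Suc)
    then show "inj_on (\<lambda>i. E i q) {..<k} \<and> independent ((\<lambda>i. E i q) ` {..<k})" "E k q \<notin> ?S q"
      by (auto simp: independent_insert split: if_splits)
  qed
  have IH: "\<exists>Y. smooth_vfield_on M W Y \<and> (\<forall>q\<in>W. Y q \<in> ?S q \<and>
      (\<forall>s\<in>?S q. metric M q (X q - Y q) s = 0))" if "smooth_vfield_on M W X" for X
    by (rule Suc.IH) (use Suc.prems(1) frame that in auto)
  have E: "smooth_vfield_on M W (E k)" using Suc.prems(1) by simp
  obtain P where P: "smooth_vfield_on M W P" "\<And>q. q \<in> W \<Longrightarrow> P q \<in> ?S q"
    "\<And>q s. q \<in> W \<Longrightarrow> s \<in> ?S q \<Longrightarrow> metric M q (E k q - P q) s = 0"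
    using IH[OF E] by blast
  obtain Y where Y: "smooth_vfield_on M W Y" "\<And>q. q \<in> W \<Longrightarrow> Y q \<in> ?S q"
    "\<And>q s. q \<in> W \<Longrightarrow> s \<in> ?S q \<Longrightarrow> metric M q (X q - Y q) s = 0"
    using IH[OF Suc.prems(3)] by blast
  define e where "e q = E k q - P q" for q
  \<comment> \<open>The Fourier coefficient of \<open>X\<close> along \<open>e\<close>.\<close>
  define c where "c q = metric M q (X q) (e q) * inverse (metric M q (e q) (e q))" for q
  have e: "smooth_vfield_on M W e"
    unfolding e_def using smooth_vfield_on_diff[OF smooth_manifold W E P(1)] .
  have tan: "e q \<in> tangent M q" "X q \<in> tangent M q" "Y q \<in> tangent M q" "?S q \<subseteq> tangent M q"
    if "q \<in> W" for q
  proof -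
    show "e q \<in> tangent M q" "X q \<in> tangent M q" "Y q \<in> tangent M q"
      using that e Suc.prems(3) Y(1) by (simp_all add: smooth_vfield_on_def)
    show "?S q \<subseteq> tangent M q"
      using that Suc.prems(1) by (intro span_minimal tangent_subspace) (auto simp: smooth_vfield_on_def)
  qed
  \<comment> \<open>If \<open>e\<close> vanished at \<open>q\<close>, then
    \<open>E k q = P q\<close> would lie in the span of the earlier vectors.\<close>
  have ee: "metric M q (e q) (e q) \<noteq> 0" if "q \<in> W" for q
    using metric_self_eq_0[of "e q" q] tan(1)[OF that] notin[OF that] P(2)[OF that]
    by (auto simp: e_def)
  have c: "smooth_fun_on M W c"
    unfolding c_def
    by (intro smooth_fun_on_mult smooth_fun_on_inverse smooth_manifold W smooth_metric e ee Suc.prems(3))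
  \<comment> \<open>The factor 1 gives \<open>Z\<close> the shape required by
    \<open>smooth_vfield_on_lincomb\<close>.\<close>
  define Z where "Z q = 1 *\<^sub>R Y q + c q *\<^sub>R e q" for q
  have "smooth_vfield_on M W Z"
    unfolding Z_def by (intro smooth_vfield_on_lincomb smooth_manifold W Y(1) e c smooth_fun_on_const)
  moreover have "Z q \<in> span ((\<lambda>i. E i q) ` {..<Suc k}) \<and>
      (\<forall>s\<in>span ((\<lambda>i. E i q) ` {..<Suc k}). metric M q (X q - Z q) s = 0)" if q: "q \<in> W" for q
  proof (intro conjI ballI)
    note t = tan[OF q]
    have sub: "?S q \<subseteq> span ((\<lambda>i. E i q) ` {..<Suc k})"
      by (intro span_mono) auto
    moreover have "E k q \<in> span ((\<lambda>i. E i q) ` {..<Suc k})"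
      by (intro span_base) auto
    ultimately show "Z q \<in> span ((\<lambda>i. E i q) ` {..<Suc k})"
      unfolding Z_def e_def using Y(2)[OF q] P(2)[OF q]
      by (intro span_add span_scale span_diff) auto
    fix s assume "s \<in> span ((\<lambda>i. E i q) ` {..<Suc k})"
    \<comment> \<open>Replacing \<open>E k\<close> by \<open>e\<close> changes \<open>s\<close> only
      by a multiple of \<open>P q\<close>, which lies in the smaller span; hence \<open>s\<close> is
      an element of that span plus a multiple of \<open>e q\<close>.\<close>
    then obtain a where "s - a *\<^sub>R E k q \<in> ?S q"
      by (auto simp: lessThan_Suc span_insert)
    then have "s - a *\<^sub>R E k q + a *\<^sub>R P q \<in> ?S q"
      using P(2)[OF q] by (intro span_add span_scale)
    then obtain r where r: "r \<in> ?S q" "s = r + a *\<^sub>R e q"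
      by (simp add: e_def algebra_simps)
    have XY: "metric M q (X q) r = metric M q (Y q) r"
      using Y(3)[OF q r(1)] t r(1) by (simp add: metric_simps subset_iff)
    have er: "metric M q (e q) r = 0"
      using P(3)[OF q r(1)] by (simp add: e_def)
    \<comment> \<open>\<open>Y q\<close> lies in the earlier span, to which \<open>e q\<close> is
      orthogonal. With \<open>XY\<close> and \<open>er\<close>, the pairing of \<open>X - Z\<close>
      with \<open>s\<close> reduces to \<open>a\<close> times g(X,e) - c g(e,e), which is zero by
      the choice of \<open>c\<close>.\<close>
    have "metric M q (Y q) (e q) = 0"
      using P(3)[OF q Y(2)[OF q]] metric_commute[OF t(1,3)] by (simp add: e_def)
    then show "metric M q (X q - Z q) s = 0"
      using t r XY er ee[OF q]
      by (simp add: Z_def c_def metric_simps tangent_closed subset_iff)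
  qed
  ultimately show ?case by blast
qed

section \<open>Orthogonal projection onto a smooth distribution\<close>

lemma orth_proj_eqI:
  assumes S: "subspace S" "S \<subseteq> tangent M p" and v: "v \<in> tangent M p"
    and w: "w \<in> S" "\<And>s. s \<in> S \<Longrightarrow> metric M p (v - w) s = 0"
  shows "orth_proj M p S v = w"
  unfolding orth_proj_def
proof (rule the_equality)
  fix w' assume w': "w' \<in> S \<and> (\<forall>s\<in>S. metric M p (v - w') s = 0)"
  \<comment> \<open>Two candidates differ by an element of \<open>S\<close> that is orthogonal to
    \<open>S\<close>, hence to itself, so definiteness of the metric makes them equal.\<close>
  let ?d = "w' - w"
  have d: "?d \<in> S" using S(1) w(1) w' by (simp add: subspace_diff)
  have t: "w \<in> tangent M p" "w' \<in> tangent M p" "?d \<in> tangent M p"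
    using S(2) w(1) w' d by auto
  have "metric M p (v - w) ?d = 0" "metric M p (v - w') ?d = 0"
    using w(2)[OF d] w' d by auto
  then have "metric M p ?d ?d = 0"
    using t v by (simp add: metric_diff_left)
  then show "w' = w"
    using metric_self_eq_0[OF t(3)] by simp
qed (use w in auto)

lemma smooth_distribution_subspace:
  assumes "smooth_distribution M D"
  shows "subspace (D p)" "D p \<subseteq> tangent M p"
proof -
  obtain k W E where k: "p \<in> W" "\<And>i. i < (k::nat) \<Longrightarrow> smooth_vfield_on M W (E i)"
      "span ((\<lambda>i. E i p) ` {..<k}) = D p"
    using assms unfolding smooth_distribution_def by metis
  show "subspace (D p)" using k(3) subspace_span by metis
  have "(\<lambda>i. E i p) ` {..<k} \<subseteq> tangent M p"
    using k(1,2) by (auto simp: smooth_vfield_on_def)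
  then show "D p \<subseteq> tangent M p" using span_minimal[OF _ tangent_subspace] k(3) by metis
qed

text \<open>The pointwise projection is a global field, while Gram-Schmidt yields smooth projections
  near each point. Uniqueness of the projection identifies them, and smoothness is local.\<close>

lemma smooth_distribution_projection:
  assumes D: "smooth_distribution M D" and X: "X \<in> vfields M"
  obtains Y where "Y \<in> sections M D" "\<And>p s. s \<in> D p \<Longrightarrow> metric M p (X p - Y p) s = 0"
proof -
  define Y where "Y p = orth_proj M p (D p) (X p)" for p
  have loc: "\<exists>W Y'. open W \<and> p \<in> W \<and> smooth_vfield_on M W Y' \<and>
      (\<forall>q\<in>W. Y' q \<in> D q \<and> (\<forall>s\<in>D q. metric M q (X q - Y' q) s = 0))" for p
  proof -
    obtain k W E where W: "open W" "p \<in> W" "\<And>i. i < (k::nat) \<Longrightarrow> smooth_vfield_on M W (E i)"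
      and fr: "\<And>q. q \<in> W \<Longrightarrow> inj_on (\<lambda>i. E i q) {..<k} \<and> independent ((\<lambda>i. E i q) ` {..<k})"
      and sp: "\<And>q. q \<in> W \<Longrightarrow> span ((\<lambda>i. E i q) ` {..<k}) = D q"
      using D unfolding smooth_distribution_def by metis
    have "smooth_vfield_on M W X"
      using X smooth_vfield_on_subset[of M UNIV X W] by (simp add: vfields_def)
    from frame_projection[OF W(1,3) fr this] show ?thesis
      using W(1,2) sp by auto
  qed
  have Xt: "X q \<in> tangent M q" for q
    using X by (simp add: vfields_def smooth_vfield_on_def)
  have eq: "Y q = y" if "y \<in> D q" "\<forall>s\<in>D q. metric M q (X q - y) s = 0" for q y
    unfolding Y_def using that by (intro orth_proj_eqI smooth_distribution_subspace[OF D] Xt) auto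
  have "smooth_vfield_on M UNIV Y"
  proof (rule smooth_vfield_on_local[OF smooth_manifold])
    fix p show "\<exists>W Y'. open W \<and> p \<in> W \<and> smooth_vfield_on M W Y' \<and> (\<forall>q\<in>W. Y q = Y' q)"
      using loc[of p] eq by metis
  qed
  moreover have "Y p \<in> D p \<and> (\<forall>s\<in>D p. metric M p (X p - Y p) s = 0)" for p
    using loc[of p] eq by metis
  ultimately show ?thesis
    by (intro that[of Y]) (auto simp: sections_def vfields_def)
qed

end

section \<open>Geometry of the fibres\<close>

locale bi_slant =
  fixes M :: "('m::{t2_space,second_countable_topology}, 'a::euclidean_space) acm"
    and N :: "('n::{t2_space,second_countable_topology}, 'b::euclidean_space) riem"
    and nabla :: "'m connection"
    and F :: "'m \<Rightarrow> 'n"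
    and D1 D2 :: "'m distribution"
    and \<theta>1 \<theta>2 :: real
  assumes levi_civita: "levi_civita M nabla"
    and sasakian: "sasakian M nabla"
    and submersion: "bi_slant_submersion M N F D1 D2 \<theta>1 \<theta>2"
begin

abbreviation g where "g \<equiv> metric M"
abbreviation V where "V \<equiv> vertical M N F"
abbreviation H where "H \<equiv> horizontal M N F"

lemma almost_contact: "almost_contact_metric M"
  using sasakian unfolding sasakian_def contact_metric_def by (elim conjE)

sublocale riemannian M
  using almost_contact unfolding almost_contact_metric_def by unfold_locales (elim conjE)

section \<open>Pointwise identities of the contact structure and of the splitting\<close>

lemma phi_tangent: "u \<in> tangent M p \<Longrightarrow> phi M p u \<in> tangent M p"
proof -
  have "\<forall>p. phi M p ` tangent M p \<subseteq> tangent M p \<and> linear_map_on (tangent M p) (phi M p)"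
    using almost_contact unfolding almost_contact_metric_def by (elim conjE)
  then show "u \<in> tangent M p \<Longrightarrow> phi M p u \<in> tangent M p" by blast
qed

lemma phi_field_vfields:
  assumes "X \<in> vfields M"
  shows "phi_field M X \<in> vfields M"
proof -
  have "\<forall>W X. open W \<longrightarrow> smooth_vfield_on M W X \<longrightarrow> smooth_vfield_on M W (phi_field M X)"
    using almost_contact unfolding almost_contact_metric_def by (elim conjE)
  then show ?thesis using assms by (simp add: vfields_def)
qed

lemma xi_vfields: "xi M \<in> vfields M"
  using almost_contact unfolding almost_contact_metric_def by (elim conjE)

lemma vfields_tangent: "X \<in> vfields M \<Longrightarrow> X p \<in> tangent M p"
  by (simp add: vfields_def smooth_vfield_on_def)

lemmas xi_tangent = vfields_tangent[OF xi_vfields]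

lemma metric_phi_phi:
  assumes "u \<in> tangent M p" "v \<in> tangent M p"
  shows "g p (phi M p u) (phi M p v) = g p u v - eta M p u * eta M p v"
proof -
  have "\<forall>p. \<forall>u\<in>tangent M p. \<forall>v\<in>tangent M p.
      g p (phi M p u) (phi M p v) = g p u v - eta M p u * eta M p v"
    using almost_contact unfolding almost_contact_metric_def by (elim conjE)
  then show ?thesis using assms by blast
qed

text \<open>Compatibility of the metric with \<phi>, applied to \<open>u\<close> and \<xi>: one side
  is zero since \<phi> \<xi> = 0, and \<eta>(\<xi>) = 1.\<close>

lemma eta_eq_metric_xi:
  assumes "u \<in> tangent M p"
  shows "eta M p u = g p u (xi M p)"
proof -
  have "\<forall>p. phi M p (xi M p) = 0" "\<forall>p. eta M p (xi M p) = 1"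
    by (insert almost_contact, unfold almost_contact_metric_def, (elim conjE, assumption)+)
  then show ?thesis
    using metric_phi_phi[OF assms xi_tangent] metric_zero_right[OF phi_tangent[OF assms]] by simp
qed

lemma metric_xi_phi:
  assumes "u \<in> tangent M p"
  shows "g p (xi M p) (phi M p u) = 0"
proof -
  have "\<forall>p. \<forall>u\<in>tangent M p. eta M p (phi M p u) = 0"
    using almost_contact unfolding almost_contact_metric_def by (elim conjE)
  then have "eta M p (phi M p u) = 0"
    using assms by blast
  then show ?thesis
    using eta_eq_metric_xi[OF phi_tangent[OF assms]] metric_commute[OF xi_tangent phi_tangent[OF assms]]
    by simp
qed

lemma
  shows xi_section: "xi M \<in> sections M H"
    and D1: "smooth_distribution M D1" and D2: "smooth_distribution M D2"
    and vertical_eq: "\<forall>p. V p = {u + v |u v. u \<in> D1 p \<and> v \<in> D2 p}"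
    and D1_orth_D2: "\<forall>p. \<forall>u\<in>D1 p. \<forall>v\<in>D2 p. g p u v = 0"
  by (insert submersion, unfold bi_slant_submersion_def, (elim conjE, assumption)+)

lemmas D1_subspace = smooth_distribution_subspace(1)[OF D1]
  and D1_tangent = smooth_distribution_subspace(2)[OF D1]
  and D2_subspace = smooth_distribution_subspace(1)[OF D2]
  and D2_tangent = smooth_distribution_subspace(2)[OF D2]

lemma vertical_tangent: "v \<in> V p \<Longrightarrow> v \<in> tangent M p"
  by (simp add: vertical_def)

lemma horizontal_tangent: "v \<in> H p \<Longrightarrow> v \<in> tangent M p"
  by (simp add: horizontal_def)

lemma metric_horizontal_vertical: "h \<in> H p \<Longrightarrow> v \<in> V p \<Longrightarrow> g p h v = 0"
  by (simp add: horizontal_def)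

lemma metric_vertical_horizontal: "v \<in> V p \<Longrightarrow> h \<in> H p \<Longrightarrow> g p v h = 0"
  using metric_commute[OF vertical_tangent horizontal_tangent] metric_horizontal_vertical by simp

lemma D1_vertical: "v \<in> D1 p \<Longrightarrow> v \<in> V p"
  using vertical_eq subspace_0[OF D2_subspace] by force

lemma D2_vertical: "v \<in> D2 p \<Longrightarrow> v \<in> V p"
  using vertical_eq subspace_0[OF D1_subspace] by force

lemma vertical_subspace: "subspace (V p)"
  using subspace_sums[OF D1_subspace D2_subspace] vertical_eq by simp

lemma horizontal_subspace: "subspace (H p)"
  unfolding subspace_def horizontal_def
  by (auto simp: metric_simps tangent_closed vertical_tangent)

lemma xi_horizontal: "xi M p \<in> H p"
  using xi_section by (simp add: sections_def)

lemma sections_vfields: "X \<in> sections M D \<Longrightarrow> X \<in> vfields M"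
  and sections_mem: "X \<in> sections M D \<Longrightarrow> X p \<in> D p"
  by (simp_all add: sections_def)

section \<open>Vertical and horizontal parts of vector fields\<close>

lemma ver_projection:
  assumes X: "X \<in> vfields M"
  shows "ver M N F X \<in> sections M V" "X p - ver M N F X p \<in> H p"
proof -
  obtain Y1 where Y1: "Y1 \<in> sections M D1" "\<And>p s. s \<in> D1 p \<Longrightarrow> g p (X p - Y1 p) s = 0"
    using smooth_distribution_projection[OF D1 X] by blast
  obtain Y2 where Y2: "Y2 \<in> sections M D2" "\<And>p s. s \<in> D2 p \<Longrightarrow> g p (X p - Y2 p) s = 0"
    using smooth_distribution_projection[OF D2 X] by blast
  \<comment> \<open>Smooth frames are given for \<open>D1\<close> and \<open>D2\<close> separately.
    The two projections add up to the vertical one because each is orthogonal to the other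
    distribution.\<close>
  define Y where "Y p = Y1 p + Y2 p" for p
  note Yt = vfields_tangent[OF sections_vfields[OF Y1(1)]] vfields_tangent[OF sections_vfields[OF Y2(1)]]
    vfields_tangent[OF X]
  have YV: "Y p \<in> V p" for p
    using vertical_eq sections_mem[OF Y1(1)] sections_mem[OF Y2(1)] unfolding Y_def by blast
  have YH: "X p - Y p \<in> H p" for p
  proof -
    have "g p (X p - Y p) s = 0" if s: "s \<in> V p" for s
    proof -
      obtain u v where uv: "s = u + v" "u \<in> D1 p" "v \<in> D2 p"
        using s vertical_eq by auto
      have t: "u \<in> tangent M p" "v \<in> tangent M p"
        using uv D1_tangent D2_tangent by auto
      have "g p (Y1 p) v = 0" "g p u (Y2 p) = 0"
        using D1_orth_D2 uv sections_mem[OF Y1(1)] sections_mem[OF Y2(1)] by blast+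
      then show ?thesis
        using Y1(2)[OF uv(2)] Y2(2)[OF uv(3)] t Yt metric_commute[OF t(1) Yt(2)]
        by (simp add: uv(1) Y_def metric_simps tangent_closed)
    qed
    then show ?thesis
      using Yt by (simp add: horizontal_def Y_def tangent_closed)
  qed
  have eq: "ver M N F X = Y"
    unfolding ver_def using YV YH
    by (intro ext orth_proj_eqI vertical_subspace)
      (auto simp: vertical_tangent vfields_tangent[OF X] metric_horizontal_vertical)
  have "smooth_vfield_on M UNIV Y"
    unfolding Y_def using sections_vfields[OF Y1(1)] sections_vfields[OF Y2(1)]
    by (intro smooth_vfield_on_add smooth_manifold) (auto simp: vfields_def)
  then show "ver M N F X \<in> sections M V" "X p - ver M N F X p \<in> H p"
    using YV YH eq by (auto simp: sections_def vfields_def)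
qed

text \<open>The part \<open>ver M N F X\<close> is orthogonal to the horizontal space, so the
  remainder of \<open>X\<close>, which is horizontal, satisfies the characterisation of the
  projection.\<close>

lemma hor_eq:
  assumes X: "X \<in> vfields M"
  shows "hor M N F X = (\<lambda>p. X p - ver M N F X p)"
  unfolding hor_def using ver_projection[OF X]
  by (intro ext orth_proj_eqI horizontal_subspace)
    (auto simp: horizontal_tangent vfields_tangent[OF X] sections_def metric_vertical_horizontal)

lemma hor_section:
  assumes X: "X \<in> vfields M"
  shows "hor M N F X \<in> sections M H"
proof -
  have "smooth_vfield_on M UNIV (\<lambda>p. X p - ver M N F X p)"
    using X sections_vfields[OF ver_projection(1)[OF X]]
    by (intro smooth_vfield_on_diff smooth_manifold) (auto simp: vfields_def)
  then show ?thesis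
    using ver_projection(2)[OF X] by (simp add: hor_eq[OF X] sections_def vfields_def)
qed

lemma ver_add_hor:
  "X \<in> vfields M \<Longrightarrow> ver M N F X p + hor M N F X p = X p"
  by (simp add: hor_eq)

lemma metric_ver:
  assumes X: "X \<in> vfields M" and v: "v \<in> V p"
  shows "g p (ver M N F X p) v = g p (X p) v"
  using metric_horizontal_vertical[OF ver_projection(2)[OF X] v] vertical_tangent[OF v]
    vfields_tangent[OF X] vfields_tangent[OF sections_vfields[OF ver_projection(1)[OF X]]]
  by (simp add: metric_simps)

lemma metric_hor:
  assumes X: "X \<in> vfields M" and h: "h \<in> H p"
  shows "g p (hor M N F X p) h = g p (X p) h"
  using metric_vertical_horizontal[OF sections_mem[OF ver_projection(1)[OF X]] h]
    horizontal_tangent[OF h] vfields_tangent[OF X]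
    vfields_tangent[OF sections_vfields[OF ver_projection(1)[OF X]]]
  by (simp add: hor_eq[OF X] metric_simps)

lemma ver_vertical:
  assumes U: "U \<in> sections M V"
  shows "ver M N F U = U"
  unfolding ver_def using sections_mem[OF U]
  by (intro ext orth_proj_eqI vertical_subspace) (auto simp: vertical_tangent metric_zero_left)

section \<open>Bracket of vertical fields and horizontality of their image under \<phi>\<close>

lemma nabla_vfields: "X \<in> vfields M \<Longrightarrow> Y \<in> vfields M \<Longrightarrow> nabla X Y \<in> vfields M"
  using levi_civita unfolding levi_civita_def by (elim conjE) blast

lemma zero_vfields: "(\<lambda>p. 0) \<in> vfields M"
  using smooth_vfield_on_zero[OF smooth_manifold] by (simp add: vfields_def)

lemma nabla_zero:
  assumes X: "X \<in> vfields M"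
  shows "nabla X (\<lambda>p. 0) = (\<lambda>p. 0)"
proof -
  have "\<forall>X\<in>vfields M. \<forall>Y\<in>vfields M. \<forall>Y'\<in>vfields M.
      nabla X (\<lambda>p. Y p + Y' p) = (\<lambda>p. nabla X Y p + nabla X Y' p)"
    using levi_civita unfolding levi_civita_def by (elim conjE)
  \<comment> \<open>Additivity at two zero fields says that the derivative equals twice
    itself.\<close>
  from bspec[OF bspec[OF bspec[OF this X] zero_vfields] zero_vfields]
  show ?thesis by (simp add: fun_eq_iff)
qed

text \<open>A vertical field annihilates every smooth function pulled back from \<open>N\<close>, so
  both terms of the commutator vanish on such functions.\<close>

lemma lie_bracket_vertical:
  assumes U: "U \<in> sections M V" and W: "W \<in> sections M V"
  shows "lie_bracket M U W p \<in> V p"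
proof -
  have kill: "deriv_along Y (h \<circ> F) = (\<lambda>q. 0)" if "Y \<in> sections M V" "h \<in> Cinf N" for Y h
  proof
    fix q
    have "app (pushforward M N F (Y q)) h = 0"
      using sections_mem[OF that(1), of q] by (simp add: vertical_def app_simps)
    then show "deriv_along Y (h \<circ> F) q = 0"
      using that(2) by (simp add: pushforward_def Functional_inverse deriv_along_def)
  qed
  have tan: "U p \<in> tangent M p" "W p \<in> tangent M p"
    using U W vertical_tangent sections_mem by blast+
  \<comment> \<open>The default value 0 of the bracket outside \<open>Cinf M\<close> agrees with the
    value found inside, so both cases for the pullback are covered.\<close>
  have "app (lie_bracket M U W p) (h \<circ> F) = 0" if "h \<in> Cinf N" for h
    using kill[OF U that] kill[OF W that] tan
    by (simp add: lie_bracket_def Functional_inverse app_tangent_zero[OF smooth_manifold])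
  then have "pushforward M N F (lie_bracket M U W p) = Functional (\<lambda>h. 0)"
    unfolding pushforward_def by (intro arg_cong[of _ _ Functional] ext) simp
  then have "pushforward M N F (lie_bracket M U W p) = 0"
    by (simp add: zero_functional_def)
  \<comment> \<open>Vanishing torsion makes the bracket a difference of covariant derivatives and
    thus tangent.\<close>
  moreover have "\<forall>X\<in>vfields M. \<forall>Y\<in>vfields M. (\<lambda>p. nabla X Y p - nabla Y X p) = lie_bracket M X Y"
    using levi_civita unfolding levi_civita_def by (elim conjE)
  then have "lie_bracket M U W = (\<lambda>p. nabla U W p - nabla W U p)"
    using sections_vfields[OF U] sections_vfields[OF W] by metis
  then have "lie_bracket M U W p \<in> tangent M p"
    using sections_vfields[OF U] sections_vfields[OF W]
    by (simp add: tangent_closed vfields_tangent nabla_vfields)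
  ultimately show ?thesis by (simp add: vertical_def)
qed

lemma eta_vertical: "v \<in> V p \<Longrightarrow> eta M p v = 0"
  using eta_eq_metric_xi[OF vertical_tangent] metric_vertical_horizontal[OF _ xi_horizontal] by simp

text \<open>The contact condition turns the pairing into d\<eta>(U, W), whose terms all vanish:
  \<eta> is zero on \<open>U\<close>, on \<open>W\<close> and on their vertical bracket.\<close>

lemma metric_phi_vertical:
  assumes U: "U \<in> sections M V" and W: "W \<in> sections M V"
  shows "g p (U p) (phi M p (W p)) = 0"
proof -
  have "\<forall>X\<in>vfields M. \<forall>Y\<in>vfields M. d_eta M X Y = (\<lambda>p. g p (X p) (phi M p (Y p)))"
    using sasakian unfolding sasakian_def contact_metric_def by (elim conjE)
  then have "g p (U p) (phi M p (W p)) = d_eta M U W p"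
    using sections_vfields[OF U] sections_vfields[OF W] by simp
  moreover have "eta_field M U = (\<lambda>p. 0)" "eta_field M W = (\<lambda>p. 0)"
    using eta_vertical sections_mem[OF U] sections_mem[OF W] by (auto simp: eta_field_def)
  ultimately show ?thesis
    using eta_vertical[OF lie_bracket_vertical[OF U W]]
      app_tangent_zero[OF smooth_manifold vfields_tangent[OF sections_vfields[OF U]]]
      app_tangent_zero[OF smooth_manifold vfields_tangent[OF sections_vfields[OF W]]]
    by (simp add: d_eta_def deriv_along_def)
qed

text \<open>The vertical part of \<phi> W is itself a vertical section, so
  \<open>metric_phi_vertical\<close> applies to it and its length is zero.\<close>

lemma varphi_vertical:
  assumes W: "W \<in> sections M V"
  shows "varphi M N F W = (\<lambda>p. 0)"
proof
  fix p
  have P: "phi_field M W \<in> vfields M"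
    using phi_field_vfields sections_vfields[OF W] by blast
  define Y where "Y = ver M N F (phi_field M W)"
  have Y: "Y \<in> sections M V"
    unfolding Y_def by (rule ver_projection(1)[OF P])
  have t: "Y p \<in> tangent M p" using vertical_tangent[OF sections_mem[OF Y]] .
  have "g p (Y p) (Y p) = g p (phi_field M W p) (Y p)"
    using metric_ver[OF P sections_mem[OF Y]] unfolding Y_def .
  also have "\<dots> = 0"
    using metric_phi_vertical[OF Y W] metric_commute[OF t vfields_tangent[OF P]]
    by (simp add: phi_field_def)
  finally show "varphi M N F W p = 0"
    using metric_self_eq_0[OF t] by (simp add: varphi_def Y_def)
qed

lemma omega_vertical: "W \<in> sections M V \<Longrightarrow> omega M N F W = phi_field M W"
  using varphi_vertical[of W] hor_eq[OF phi_field_vfields[OF sections_vfields]]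
  by (simp add: omega_def varphi_def)

lemma phi_zero: "phi M p 0 = 0"
proof -
  have "\<forall>p. phi M p ` tangent M p \<subseteq> tangent M p \<and> linear_map_on (tangent M p) (phi M p)"
    using almost_contact unfolding almost_contact_metric_def by (elim conjE)
  then have "phi M p (0 *\<^sub>R 0 + 0 *\<^sub>R 0) = 0 *\<^sub>R phi M p 0 + 0 *\<^sub>R phi M p 0"
    using tangent_closed(1) unfolding linear_map_on_def by blast
  then show ?thesis by simp
qed

lemma zero_vertical: "(\<lambda>p. 0) \<in> sections M V"
  using zero_vfields subspace_0[OF vertical_subspace] by (simp add: sections_def)

lemma ver_zero: "ver M N F (\<lambda>p. 0) = (\<lambda>p. 0)"
  by (rule ver_vertical[OF zero_vertical])

lemma hor_zero: "hor M N F (\<lambda>p. 0) = (\<lambda>p. 0)"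
  by (simp add: hor_eq[OF zero_vfields] ver_zero)

lemma phi_field_horizontal:
  assumes W: "W \<in> sections M V"
  shows "phi_field M W \<in> sections M H"
  using hor_section[OF phi_field_vfields[OF sections_vfields[OF W]]] omega_vertical[OF W]
  by (simp add: omega_def)

lemma hor_horizontal:
  assumes X: "X \<in> sections M H"
  shows "hor M N F X = X" "ver M N F X = (\<lambda>p. 0)"
proof -
  show z: "ver M N F X = (\<lambda>p. 0)"
    unfolding ver_def using sections_mem[OF X]
    by (intro ext orth_proj_eqI vertical_subspace)
      (auto simp: vertical_tangent horizontal_tangent subspace_0[OF vertical_subspace]
        metric_horizontal_vertical)
  show "hor M N F X = X"
    by (simp add: hor_eq[OF sections_vfields[OF X]] z)
qed

section \<open>The O'Neill tensor and the covariant derivative of \<phi> along the fibres\<close>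

lemma oneill_T_vertical_horizontal:
  assumes "U \<in> sections M V" "X \<in> sections M H"
  shows "oneill_T M N F nabla U X = ver M N F (nabla U X)"
  \<comment> \<open>The first summand of the tensor differentiates the vertical part of
    \<open>X\<close>, which is the zero field.\<close>
  using assms nabla_zero[OF sections_vfields[OF assms(1)]]
  by (simp add: oneill_T_def ver_vertical hor_horizontal hor_zero)

text \<open>Differentiating g(W, \<xi>) = 0 along \<open>U\<close> moves the derivative onto \<xi>,
  where it equals -\<phi> U and is orthogonal to \<open>W\<close>.\<close>

lemma eta_nabla_vertical:
  assumes U: "U \<in> sections M V" and W: "W \<in> sections M V"
  shows "eta M p (nabla U W p) = 0"
proof -
  note f = sections_vfields[OF U] sections_vfields[OF W]
  have "\<forall>X\<in>vfields M. \<forall>Y\<in>vfields M. \<forall>Z\<in>vfields M. deriv_along X (\<lambda>p. g p (Y p) (Z p))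
      = (\<lambda>p. g p (nabla X Y p) (Z p) + g p (Y p) (nabla X Z p))"
    using levi_civita unfolding levi_civita_def by (elim conjE)
  then have "deriv_along U (\<lambda>p. g p (W p) (xi M p))
      = (\<lambda>p. g p (nabla U W p) (xi M p) + g p (W p) (nabla U (xi M) p))"
    using f xi_vfields by blast
  moreover have "(\<lambda>p. g p (W p) (xi M p)) = (\<lambda>p. 0)"
    using metric_vertical_horizontal[OF sections_mem[OF W] xi_horizontal] by auto
  moreover have "deriv_along U (\<lambda>p. 0) p = 0"
    using app_tangent_zero[OF smooth_manifold vfields_tangent[OF f(1)]] by (simp add: deriv_along_def)
  moreover have "\<forall>X\<in>vfields M. \<forall>p. nabla X (xi M) p = - phi M p (X p)"
    using sasakian unfolding sasakian_def by (elim conjE)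
  then have "g p (W p) (nabla U (xi M) p) = - g p (W p) (phi M p (U p))"
    using f metric_scale_right[of "W p" p "phi M p (U p)" "-1"]
    by (simp add: vfields_tangent phi_tangent)
  ultimately have "g p (nabla U W p) (xi M p) = 0"
    using metric_phi_vertical[OF W U, of p] by (simp add: fun_eq_iff)
  then show ?thesis
    using eta_eq_metric_xi vfields_tangent nabla_vfields[OF f] by simp
qed

text \<open>As \<eta>(W) = 0, the structure equation leaves \<phi> applied to
  \<open>nabla U W\<close> plus a multiple of \<xi>. Pairing with \<phi> x removes the \<xi>-term;
  stripping \<phi> from both arguments costs a product of \<eta>-values that vanishes by
  \<open>eta_nabla_vertical\<close>.\<close>

lemma metric_nabla_phi:
  assumes U: "U \<in> sections M V" and W: "W \<in> sections M V" and x: "x \<in> tangent M p"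
  shows "g p (nabla U (phi_field M W) p) (phi M p x) = g p (nabla U W p) x"
proof -
  note f = sections_vfields[OF U] sections_vfields[OF W]
  have nt: "nabla U W p \<in> tangent M p"
    using vfields_tangent nabla_vfields[OF f] by blast
  have "\<forall>X\<in>vfields M. \<forall>Y\<in>vfields M. \<forall>p. nabla X (phi_field M Y) p - phi M p (nabla X Y p)
      = g p (X p) (Y p) *\<^sub>R xi M p - eta M p (Y p) *\<^sub>R X p"
    using sasakian unfolding sasakian_def by (elim conjE)
  then have "nabla U (phi_field M W) p - phi M p (nabla U W p) = g p (U p) (W p) *\<^sub>R xi M p"
    using f eta_vertical[OF sections_mem[OF W]] by simp
  then have "nabla U (phi_field M W) p = phi M p (nabla U W p) + g p (U p) (W p) *\<^sub>R xi M p"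
    by (simp add: algebra_simps)
  then have "g p (nabla U (phi_field M W) p) (phi M p x) = g p (phi M p (nabla U W p)) (phi M p x)"
    using nt x by (simp add: metric_simps tangent_closed phi_tangent xi_tangent metric_xi_phi)
  then show ?thesis
    using metric_phi_phi[OF nt x] eta_nabla_vertical[OF U W] by simp
qed

text \<open>Since \<open>varphi\<close> vanishes on vertical fields, both terms with the O'Neill
  tensor are zero. The last one pairs \<open>nabla U (phi_field M Y)\<close> with the horizontal
  field \<open>phi_field M W\<close>, where \<open>metric_nabla_phi\<close> applies.\<close>

lemma D2_condition_iff:
  assumes U: "U \<in> sections M V" and Y: "Y \<in> sections M V" and W: "W \<in> sections M V"
  shows "- g p (oneill_T M N F nabla U (omega M N F (varphi M N F Y)) p) (W p)
         = g p (oneill_T M N F nabla U (omega M N F Y) p) (varphi M N F W p)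
           + g p (hor M N F (nabla U (omega M N F Y)) p) (omega M N F W p)
      \<longleftrightarrow> g p (nabla U Y p) (W p) = 0"
proof -
  note PY = phi_field_horizontal[OF Y] and PW = phi_field_horizontal[OF W]
  have n: "nabla U (phi_field M Y) \<in> vfields M"
    using nabla_vfields sections_vfields U PY by blast
  have z: "omega M N F (\<lambda>p. 0) = (\<lambda>p. 0)"
    by (simp add: omega_vertical[OF zero_vertical] phi_field_def phi_zero)
  have "oneill_T M N F nabla U (\<lambda>p. 0) = (\<lambda>p. 0)"
    using nabla_zero[OF sections_vfields[OF U]]
    by (simp add: oneill_T_def ver_vertical[OF U] ver_zero hor_zero)
  moreover have "g p (oneill_T M N F nabla U (phi_field M Y) p) 0 = 0"
    using metric_zero_right vertical_tangent sections_mem[OF ver_projection(1)[OF n]]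
    by (simp add: oneill_T_vertical_horizontal[OF U PY])
  moreover have "g p (hor M N F (nabla U (phi_field M Y)) p) (phi_field M W p) = g p (nabla U Y p) (W p)"
    using metric_hor[OF n sections_mem[OF PW]]
      metric_nabla_phi[OF U Y vertical_tangent[OF sections_mem[OF W]]]
    by (simp add: phi_field_def)
  ultimately show ?thesis
    using metric_zero_left vertical_tangent[OF sections_mem[OF W]]
    by (simp add: varphi_vertical[OF Y] varphi_vertical[OF W] omega_vertical[OF Y]
        omega_vertical[OF W] z)
qed

text \<open>The term containing \<open>varphi\<close> is zero. The other two pair
  \<open>nabla U (phi_field M Y)\<close> with the vertical and the horizontal part of \<phi> X; on
  one side they add up to the pairing with \<phi> X itself.\<close>

lemma horizontal_condition_iff:
  assumes U: "U \<in> sections M V" and Y: "Y \<in> sections M V" and X: "X \<in> sections M H"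
  shows "g p (oneill_T M N F nabla U (omega M N F Y) p) (B_part M N F X p)
         = g p (hor M N F (nabla U (omega M N F (varphi M N F Y))) p) (X p)
           - g p (hor M N F (nabla U (omega M N F Y)) p) (C_part M N F X p)
      \<longleftrightarrow> g p (nabla U Y p) (X p) = 0"
proof -
  note PY = phi_field_horizontal[OF Y]
  have n: "nabla U (phi_field M Y) \<in> vfields M"
    using nabla_vfields sections_vfields U PY by blast
  have PX: "phi_field M X \<in> vfields M"
    using phi_field_vfields sections_vfields X by blast
  have z: "omega M N F (\<lambda>p. 0) = (\<lambda>p. 0)"
    by (simp add: omega_vertical[OF zero_vertical] phi_field_def phi_zero)
  have B: "B_part M N F X p \<in> V p" and C: "C_part M N F X p \<in> H p"
    using sections_mem[OF ver_projection(1)[OF PX]] sections_mem[OF hor_section[OF PX]]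
    by (simp_all add: B_part_def C_part_def)
  have "g p (nabla U (phi_field M Y) p) (B_part M N F X p) + g p (nabla U (phi_field M Y) p) (C_part M N F X p)
      = g p (nabla U (phi_field M Y) p) (phi_field M X p)"
    using metric_add_right[OF vfields_tangent[OF n] vertical_tangent[OF B] horizontal_tangent[OF C]]
      ver_add_hor[OF PX, of p]
    by (simp add: B_part_def C_part_def)
  also have "\<dots> = g p (nabla U Y p) (X p)"
    using metric_nabla_phi[OF U Y horizontal_tangent[OF sections_mem[OF X]]]
    by (simp add: phi_field_def)
  finally show ?thesis
    using metric_ver[OF n B] metric_hor[OF n C] nabla_zero[OF sections_vfields[OF U]]
      metric_zero_left horizontal_tangent[OF sections_mem[OF X]]
    by (auto simp: varphi_vertical[OF Y] omega_vertical[OF Y] z hor_zero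
        oneill_T_vertical_horizontal[OF U PY])
qed

text \<open>For the converse, \<open>Z\<close> is tested against its own horizontal part and its own
  projection to \<open>D2\<close>, both of which are smooth global sections.\<close>

lemma D1_section_iff:
  assumes Z: "Z \<in> vfields M"
  shows "Z \<in> sections M D1 \<longleftrightarrow>
    (\<forall>W\<in>sections M D2. \<forall>X\<in>sections M H. \<forall>p. g p (Z p) (W p) = 0 \<and> g p (Z p) (X p) = 0)"
proof
  assume "Z \<in> sections M D1"
  then show "\<forall>W\<in>sections M D2. \<forall>X\<in>sections M H. \<forall>p. g p (Z p) (W p) = 0 \<and> g p (Z p) (X p) = 0"
    using D1_orth_D2 metric_vertical_horizontal[OF D1_vertical] sections_mem by blast
next
  assume orth: "\<forall>W\<in>sections M D2. \<forall>X\<in>sections M H. \<forall>p. g p (Z p) (W p) = 0 \<and> g p (Z p) (X p) = 0"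
  obtain W where W: "W \<in> sections M D2" "\<And>p s. s \<in> D2 p \<Longrightarrow> g p (Z p - W p) s = 0"
    using smooth_distribution_projection[OF D2 Z] by blast
  note h = hor_section[OF Z]
  have "Z p \<in> D1 p" for p
  proof -
    have Zt: "Z p \<in> tangent M p" using vfields_tangent[OF Z] .
    have Wt: "W p \<in> tangent M p" using vertical_tangent D2_vertical sections_mem[OF W(1)] by blast
    have "g p (hor M N F Z p) (hor M N F Z p) = 0"
      using metric_hor[OF Z sections_mem[OF h]] orth W(1) h by simp
    then have "hor M N F Z p = 0"
      using metric_self_eq_0 horizontal_tangent sections_mem[OF h] by blast
    then have "Z p \<in> V p"
      using ver_add_hor[OF Z, of p] sections_mem[OF ver_projection(1)[OF Z], of p] by simp
    then obtain u v where uv: "Z p = u + v" "u \<in> D1 p" "v \<in> D2 p"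
      using vertical_eq by auto
    then have t: "u \<in> tangent M p" "v \<in> tangent M p" "g p u v = 0"
      using D1_tangent D2_tangent D1_orth_D2 by auto
    have "g p (W p) (W p) = 0"
      using W(2)[OF sections_mem[OF W(1)], of p] orth W(1) h Zt Wt by (simp add: metric_simps)
    then have "W p = 0" using metric_self_eq_0 Wt by blast
    \<comment> \<open>With \<open>W p = 0\<close>, the vector \<open>Z p = u + v\<close> is
      orthogonal to \<open>v\<close>, and so is \<open>u\<close>.\<close>
    then have "g p v v = 0"
      using W(2)[OF uv(3)] t by (simp add: uv(1) metric_simps)
    then have "v = 0" using metric_self_eq_0 t by blast
    then show ?thesis using uv by simp
  qed
  then show "Z \<in> sections M D1" using Z by (simp add: sections_def)
qed

lemma D1_sections_vertical: "U \<in> sections M D1 \<Longrightarrow> U \<in> sections M V"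
  and D2_sections_vertical: "U \<in> sections M D2 \<Longrightarrow> U \<in> sections M V"
  using D1_vertical D2_vertical by (auto simp: sections_def)

end

theorem theorem3p4:
  fixes M :: "('m::{t2_space,second_countable_topology}, 'a::euclidean_space) acm"
    and N :: "('n::{t2_space,second_countable_topology}, 'b::euclidean_space) riem"
    and nabla :: "'m connection"
    and F :: "'m \<Rightarrow> 'n"
    and D1 D2 :: "'m distribution"
    and \<theta>1 \<theta>2 :: real
  assumes "levi_civita M nabla"
    and "sasakian M nabla"
    and "bi_slant_submersion M N F D1 D2 \<theta>1 \<theta>2"
  shows "totally_geodesic_foliation M nabla D1 \<longleftrightarrow>
    (\<forall>U\<in>sections M D1. \<forall>V\<in>sections M D1. \<forall>W\<in>sections M D2. \<forall>X\<in>sections M (horizontal M N F). \<forall>p.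
       - metric M p (oneill_T M N F nabla U (omega M N F (varphi M N F V)) p) (W p)
         = metric M p (oneill_T M N F nabla U (omega M N F V) p) (varphi M N F W p)
           + metric M p (hor M N F (nabla U (omega M N F V)) p) (omega M N F W p)
       \<and> metric M p (oneill_T M N F nabla U (omega M N F V) p) (B_part M N F X p)
         = metric M p (hor M N F (nabla U (omega M N F (varphi M N F V))) p) (X p)
           - metric M p (hor M N F (nabla U (omega M N F V)) p) (C_part M N F X p))"
proof -
  interpret bi_slant M N nabla F D1 D2 \<theta>1 \<theta>2
    using assms by unfold_locales
  have n: "nabla U Y \<in> vfields M" if "U \<in> sections M D1" "Y \<in> sections M D1" for U Y
    using nabla_vfields that sections_vfields by blast
  \<comment> \<open>For fixed \<open>U\<close> and \<open>V\<close>, \<open>D1_section_iff\<close>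
    produces the same quantifiers over \<open>W\<close>, \<open>X\<close> and \<open>p\<close> as
    the right side, so the two equivalences can be matched conjunct by conjunct.\<close>
  show ?thesis
    unfolding totally_geodesic_foliation_def
    by (intro ball_cong refl, simp only: D1_section_iff[OF n], intro ball_cong refl all_cong1)
      (simp only: D2_condition_iff horizontal_condition_iff D1_sections_vertical D2_sections_vertical)
qed

end
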